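(* Let $n>1$ be an integer, let $m\ge 0$ be an integer, and let $\tilde c_0\neq 0$ be a given real number. Let ${\bm \phi}(x)=[\phi_0(x)\;\phi_1(x)\;\cdots\;\phi_m(x)]^T$ be the vector of polynomials in the paravector variable $x=x_0+\underline{x}\in\mathcal{A}_n$ given by $${\bm \phi}(x)=e^{Hx_0}\,D_{\tilde c}\,{\bm \xi}(\underline{x}),$$ where $D_{\tilde c}=\mathrm{diag}[\tilde c_0\;\tilde c_1\;\cdots\;\tilde c_m]$ has real entries, ${\bm \xi}(\underline{x})=[1\;\underline{x}\;\underline{x}^2\;\cdots\;\underline{x}^m]^T$, and $H$ is the $(m+1)\times(m+1)$ matrix with entries $(H)_{ij}=i$ if $i=j+1$ and $(H)_{ij}=0$ otherwise, $i,j=0,1,\dots,m$; equivalently, $\phi_k(x)=\sum_{j=0}^{k}\binom{k}{j}\tilde c_j\,\underline{x}^{j}x_0^{k-j}$ for $k=0,1,\dots,m$. Suppose that $$\tilde c_{2k}=\tilde c_{2k-1}=\frac{(2k-1)!!\,(n-2)!!}{(n+2k-2)!!}\,\tilde c_0,\qquad k=1,2,\dots$$ (for all indices occurring among $1,\dots,m$). Then $$\partial{\bm \phi}(x)=H\,{\bm \phi}(x),$$ i.e. $\partial\phi_0(x)=0$ and $\partial\phi_k(x)=k\,\phi_{k-1}(x)$ for $k=1,\dots,m$.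
   Context: Let $\{e_1,\dots,e_n\}$ be an orthonormal basis of $\mathbb{R}^n$ with the non-commutative product determined by $e_ie_j+e_je_i=-2\delta_{ij}$, $i,j=1,\dots,n$. The associative $2^n$-dimensional real Clifford algebra $\mathcal{C}\ell_{0,n}$ has basis $\{e_A: A\subseteq\{1,\dots,n\}\}$, where $e_A=e_{h_1}\cdots e_{h_r}$ for $A=\{h_1<\dots<h_r\}$ and $e_\emptyset=e_0=1$. The space $\mathbb{R}^{n+1}$ is identified with $\mathcal{A}_n=\mathrm{span}_{\mathbb{R}}\{1,e_1,\dots,e_n\}\subset\mathcal{C}\ell_{0,n}$: the element $(x_0,x_1,\dots,x_n)$ is identified with the paravector $x=x_0+\underline{x}$, where $\underline{x}=\sum_{k=1}^n e_kx_k$. Powers $\underline{x}^j$ are taken in $\mathcal{C}\ell_{0,n}$, with $\underline{x}^0=1$. The hypercomplex differential operator (conjugate generalized Cauchy-Riemann operator) is $\partial=\frac12(\partial_0-\partial_{\underline{x}})$, with $\partial_0=\frac{\partial}{\partial x_0}$ and $\partial_{\underline{x}}=\sum_{k=1}^n e_k\frac{\partial}{\partial x_k}$ (the $e_k$ multiply from the left); it acts on vectors of $\mathcal{C}\ell_{0,n}$-valued functions componentwise. The double factorial is the usual one: $N!!=N(N-2)(N-4)\cdots$ down to $1$ or $2$, with $0!!=1$. *)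

theory Defs
  imports "HOL-Analysis.Derivative" "HOL-Analysis.L2_Norm" "Jordan_Normal_Form.Matrix"
begin

section \<open>The Clifford algebra\<close>

text \<open>
  An element of the Clifford algebra with generators indexed by the finite linearly ordered
  type \<open>'n\<close>, so that $n$ is \<open>CARD('n)\<close>, is given by its coordinates in the basis
  $(e_A)_{A \subseteq \{1,\dots,n\}}$.
\<close>

typedef 'n clifford = "UNIV :: ('n set \<Rightarrow> real) set"
  morphisms coeff Clifford
  by simp

setup_lifting type_definition_clifford

lemma clifford_eqI: "(\<And>A. coeff x A = coeff y A) \<Longrightarrow> x = y"
  by (metis coeff_inject ext)

lemma coeff_Clifford [simp]: "coeff (Clifford f) = f"
  by (simp add: Clifford_inverse)

text \<open>
  $e_A e_B = \pm e_{A \triangle B}$: sorting the concatenated product takes one transposition for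
  each pair $b < a$ with $a \in A$, $b \in B$, and each common index contributes $e_a^2 = -1$.
\<close>

definition blade_sign :: "'n::linorder set \<Rightarrow> 'n set \<Rightarrow> real" where
  "blade_sign A B = (- 1) ^ card {(a, b). a \<in> A \<and> b \<in> B \<and> b \<le> a}"

lemma blade_sign_prod:
  fixes A B :: "'n::{finite,linorder} set"
  shows "blade_sign A B = (\<Prod>a\<in>A. \<Prod>b\<in>B. if b \<le> a then - 1 else 1)"
proof -
  have "(\<Prod>a\<in>A. \<Prod>b\<in>B. if b \<le> a then - 1 else (1::real))
      = (\<Prod>p\<in>A \<times> B. if snd p \<le> fst p then - 1 else 1)"
    by (simp add: prod.cartesian_product case_prod_beta)
  also have "\<dots> = (\<Prod>p\<in>{p \<in> A \<times> B. snd p \<le> fst p}. - 1)"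
    by (subst prod.inter_filter) auto
  also have "{p \<in> A \<times> B. snd p \<le> fst p} = {(a, b). a \<in> A \<and> b \<in> B \<and> b \<le> a}"
    by auto
  finally show ?thesis
    by (simp add: blade_sign_def)
qed

lemma prod_sym_diff:
  fixes f :: "'a::finite \<Rightarrow> real"
  assumes "\<And>a. f a * f a = 1"
  shows "prod f (sym_diff A B) = prod f A * prod f B"
proof -
  have A: "prod f A = prod f (A - B) * prod f (A \<inter> B)"
    by (metis finite_class.finite prod.Int_Diff mult.commute)
  have B: "prod f B = prod f (B - A) * prod f (A \<inter> B)"
    by (metis finite_class.finite prod.Int_Diff mult.commute Int_commute)
  have "prod f (A \<inter> B) * prod f (A \<inter> B) = 1"
    by (simp add: assms flip: prod.distrib)
  moreover have "prod f (sym_diff A B) = prod f (A - B) * prod f (B - A)"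
    by (rule prod.union_disjoint) auto
  ultimately show ?thesis
    unfolding A B by (metis mult.assoc mult.commute mult.right_neutral)
qed

lemma blade_sign_sym_diff_left:
  fixes A B C :: "'n::{finite,linorder} set"
  shows "blade_sign (sym_diff A B) C = blade_sign A C * blade_sign B C"
  unfolding blade_sign_prod by (rule prod_sym_diff) (auto simp flip: prod.distrib intro!: prod.neutral)

lemma blade_sign_sym_diff_right:
  fixes A B C :: "'n::{finite,linorder} set"
  shows "blade_sign A (sym_diff B C) = blade_sign A B * blade_sign A C"
  unfolding blade_sign_prod
  by (subst prod_sym_diff) (auto simp: prod.distrib)

lemma blade_sign_empty [simp]: "blade_sign {} A = 1" "blade_sign A {} = 1"
  by (simp_all add: blade_sign_def)

lemma blade_sign_square [simp]: "blade_sign A B * blade_sign A B = 1"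
  by (simp add: blade_sign_def flip: power_mult_distrib)

instantiation clifford :: (type) real_vector
begin

lift_definition zero_clifford :: "'a clifford" is "\<lambda>A. 0" .
lift_definition plus_clifford :: "'a clifford \<Rightarrow> 'a clifford \<Rightarrow> 'a clifford"
  is "\<lambda>x y A. x A + y A" .
lift_definition minus_clifford :: "'a clifford \<Rightarrow> 'a clifford \<Rightarrow> 'a clifford"
  is "\<lambda>x y A. x A - y A" .
lift_definition uminus_clifford :: "'a clifford \<Rightarrow> 'a clifford"
  is "\<lambda>x A. - x A" .
lift_definition scaleR_clifford :: "real \<Rightarrow> 'a clifford \<Rightarrow> 'a clifford"
  is "\<lambda>r x A. r * x A" .

instance
  by (standard; transfer) (auto simp: algebra_simps)

end

lemma coeff_simps [simp]:
  "coeff 0 A = 0"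
  "coeff (x + y) A = coeff x A + coeff y A"
  "coeff (x - y) A = coeff x A - coeff y A"
  "coeff (- x) A = - coeff x A"
  "coeff (r *\<^sub>R x) A = r * coeff x A"
  by (transfer; simp)+

lemma coeff_sum [simp]: "coeff (\<Sum>i\<in>I. f i) A = (\<Sum>i\<in>I. coeff (f i) A)"
  by (induction I rule: infinite_finite_induct) auto

instantiation clifford :: (finite) real_normed_vector
begin

definition norm_clifford :: "'a clifford \<Rightarrow> real" where
  "norm_clifford x = L2_set (coeff x) UNIV"
definition dist_clifford :: "'a clifford \<Rightarrow> 'a clifford \<Rightarrow> real" where
  "dist_clifford x y = norm (x - y)"
definition sgn_clifford :: "'a clifford \<Rightarrow> 'a clifford" where
  "sgn_clifford x = x /\<^sub>R norm x"
definition uniformity_clifford :: "('a clifford \<times> 'a clifford) filter" where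
  "uniformity_clifford = (INF e\<in>{0<..}. principal {(x, y). dist x y < e})"
definition open_clifford :: "'a clifford set \<Rightarrow> bool" where
  "open_clifford U \<longleftrightarrow> (\<forall>x\<in>U. eventually (\<lambda>(x', y). x' = x \<longrightarrow> y \<in> U) uniformity)"

instance
proof
  fix x y :: "'a clifford" and r :: real
  show "norm x = 0 \<longleftrightarrow> x = 0"
    by (auto simp: norm_clifford_def L2_set_eq_0_iff intro: clifford_eqI)
  have "coeff (x + y) = (\<lambda>A. coeff x A + coeff y A)"
    by auto
  then show "norm (x + y) \<le> norm x + norm y"
    by (simp add: norm_clifford_def L2_set_triangle_ineq)
  have "norm (r *\<^sub>R x) = L2_set (\<lambda>A. \<bar>r\<bar> * coeff x A) UNIV"
    by (simp add: norm_clifford_def L2_set_def power_mult_distrib)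
  then show "norm (r *\<^sub>R x) = \<bar>r\<bar> * norm x"
    by (simp add: norm_clifford_def L2_set_right_distrib)
qed (simp_all add: dist_clifford_def sgn_clifford_def uniformity_clifford_def open_clifford_def)

end

instantiation clifford :: ("{finite,linorder}") real_algebra_1
begin

lift_definition one_clifford :: "'a clifford" is "\<lambda>A. if A = {} then 1 else 0" .

lift_definition times_clifford :: "'a clifford \<Rightarrow> 'a clifford \<Rightarrow> 'a clifford"
  is "\<lambda>x y C. \<Sum>A\<in>UNIV. \<Sum>B\<in>UNIV.
        if sym_diff A B = C then blade_sign A B * x A * y B else 0" .

lemma coeff_one: "coeff (1 :: 'a clifford) A = (if A = {} then 1 else 0)"
  by transfer simp

lemma coeff_times:
  "coeff (x * y :: 'a clifford) C =
     (\<Sum>A\<in>UNIV. blade_sign A (sym_diff A C) * coeff x A * coeff y (sym_diff A C))"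
proof -
  have "sym_diff A B = C \<longleftrightarrow> B = sym_diff A C" for A B
    by auto
  then show ?thesis
    by (simp add: times_clifford.rep_eq)
qed

instance
proof
  fix x y z :: "'a clifford" and r :: real
  have sd: "sym_diff (A :: 'a set) (sym_diff A B) = B" for A B
    by auto
  have sdc: "sym_diff (A :: 'a set) (sym_diff B C) = sym_diff (sym_diff A B) C" for A B C
    by auto
  show "x * y * z = x * (y * z)"
  proof (rule clifford_eqI)
    fix D
    have "coeff (x * y * z) D
      = (\<Sum>C\<in>UNIV. \<Sum>A\<in>UNIV. blade_sign C (sym_diff C D) * blade_sign A (sym_diff A C)
           * coeff x A * coeff y (sym_diff A C) * coeff z (sym_diff C D))"
      by (simp add: coeff_times sum_distrib_left sum_distrib_right mult_ac)
    also have "\<dots> = (\<Sum>A\<in>UNIV. \<Sum>C\<in>UNIV. blade_sign C (sym_diff C D) * blade_sign A (sym_diff A C)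
           * coeff x A * coeff y (sym_diff A C) * coeff z (sym_diff C D))"
      by (rule sum.swap)
    also have "\<dots> = (\<Sum>A\<in>UNIV. \<Sum>B\<in>UNIV. blade_sign A (sym_diff A D)
           * blade_sign B (sym_diff B (sym_diff A D))
           * coeff x A * coeff y B * coeff z (sym_diff B (sym_diff A D)))"
    proof (rule sum.cong[OF refl])
      fix A :: "'a set"
      show "(\<Sum>C\<in>UNIV. blade_sign C (sym_diff C D) * blade_sign A (sym_diff A C)
           * coeff x A * coeff y (sym_diff A C) * coeff z (sym_diff C D))
         = (\<Sum>B\<in>UNIV. blade_sign A (sym_diff A D) * blade_sign B (sym_diff B (sym_diff A D))
           * coeff x A * coeff y B * coeff z (sym_diff B (sym_diff A D)))"
      proof (rule sum.reindex_bij_witness[where i = "sym_diff A" and j = "sym_diff A"])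
        fix C :: "'a set"
        define B where "B = sym_diff A C"
        define E where "E = sym_diff C D"
        have C: "C = sym_diff A B"
          unfolding B_def by auto
        have BE: "sym_diff B (sym_diff A D) = E" and AD: "sym_diff A D = sym_diff B E"
          unfolding B_def E_def by auto
        have "blade_sign C E * blade_sign A B = blade_sign A (sym_diff B E) * blade_sign B E"
          unfolding C blade_sign_sym_diff_left blade_sign_sym_diff_right by simp
        then show "blade_sign A (sym_diff A D) * blade_sign (sym_diff A C) (sym_diff (sym_diff A C) (sym_diff A D))
           * coeff x A * coeff y (sym_diff A C) * coeff z (sym_diff (sym_diff A C) (sym_diff A D))
          = blade_sign C (sym_diff C D) * blade_sign A (sym_diff A C)
           * coeff x A * coeff y (sym_diff A C) * coeff z (sym_diff C D)"
          unfolding B_def[symmetric] BE E_def[symmetric] unfolding AD by simp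
      qed (auto simp: sd)
    qed
    also have "\<dots> = coeff (x * (y * z)) D"
      by (simp add: coeff_times sum_distrib_left mult_ac)
    finally show "coeff (x * y * z) D = coeff (x * (y * z)) D" .
  qed
  show "1 * x = x"
  proof (rule clifford_eqI)
    fix C
    have "coeff (1 * x) C = (\<Sum>A::'a set\<in>UNIV. if A = {} then coeff x C else 0)"
      unfolding coeff_times by (rule sum.cong) (auto simp: coeff_one)
    then show "coeff (1 * x) C = coeff x C"
      by simp
  qed
  show "x * 1 = x"
  proof (rule clifford_eqI)
    fix C
    have "coeff (x * 1) C = (\<Sum>A\<in>UNIV. if A = C then coeff x C else 0)"
      unfolding coeff_times by (rule sum.cong) (auto simp: coeff_one)
    then show "coeff (x * 1) C = coeff x C"
      by simp
  qed
  show "(0 :: 'a clifford) \<noteq> 1"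
    by (metis coeff_one coeff_simps(1) zero_neq_one)
qed (auto intro!: clifford_eqI sum.cong
       simp: coeff_times algebra_simps sum_distrib_left simp flip: sum.distrib)

end

definition blade :: "'n set \<Rightarrow> 'n clifford" where
  "blade A = Clifford (\<lambda>B. if B = A then 1 else 0)"

abbreviation gen :: "'n \<Rightarrow> 'n clifford" where
  "gen i \<equiv> blade {i}"

lemma coeff_blade: "coeff (blade A) B = (if B = A then 1 else 0)"
  by (simp add: blade_def)

lemma blade_empty: "blade {} = 1"
  by (rule clifford_eqI) (simp add: coeff_blade coeff_one)

lemma blade_times:
  fixes A B :: "'n::{finite,linorder} set"
  shows "blade A * blade B = blade_sign A B *\<^sub>R blade (sym_diff A B)"
proof (rule clifford_eqI)
  fix C
  have "coeff (blade A * blade B) C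
    = (\<Sum>A'\<in>UNIV. if A' = A then blade_sign A (sym_diff A C) * coeff (blade B) (sym_diff A C) else 0)"
    unfolding coeff_times by (rule sum.cong) (auto simp: coeff_blade)
  also have "\<dots> = blade_sign A (sym_diff A C) * coeff (blade B) (sym_diff A C)"
    by simp
  also have "\<dots> = coeff (blade_sign A B *\<^sub>R blade (sym_diff A B)) C"
  proof (cases "C = sym_diff A B")
    case True
    then have "sym_diff A C = B"
      by auto
    with True show ?thesis
      by (simp add: coeff_blade)
  next
    case False
    then have "sym_diff A C \<noteq> B"
      by auto
    with False show ?thesis
      by (simp add: coeff_blade)
  qed
  finally show "coeff (blade A * blade B) C = coeff (blade_sign A B *\<^sub>R blade (sym_diff A B)) C" .
qed

text \<open>
  The next three facts characterise the algebra: the defining relations of the generators, the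
  description of the basis elements as increasing products of generators, and the fact that they
  form a basis (the coordinates in it being \<open>coeff\<close>).
\<close>

lemma gen_anticommute:
  fixes i j :: "'n::{finite,linorder}"
  shows "gen i * gen j + gen j * gen i = (if i = j then - 2 else 0)"
proof -
  have s: "blade_sign {i} {j} = (if j \<le> i then - 1 else 1)" for i j :: 'n
    by (simp add: blade_sign_prod)
  show ?thesis
  proof (cases "i = j")
    case True
    then have "gen i * gen j + gen j * gen i = - (1 + 1)"
      by (simp add: blade_times s blade_empty)
    also have "(1 + 1 :: 'n clifford) = 2"
      by (rule one_add_one)
    finally show ?thesis
      using True by simp
  next
    case False
    have "sym_diff {j} {i} = sym_diff {i} {j}"
      by auto
    then have "gen i * gen j + gen j * gen i
      = (blade_sign {i} {j} + blade_sign {j} {i}) *\<^sub>R blade (sym_diff {i} {j})"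
      by (simp only: blade_times scaleR_add_left)
    with False show ?thesis
      by (auto simp: s)
  qed
qed

lemma blade_eq_prod_list:
  fixes A :: "'n::{finite,linorder} set"
  shows "blade A = prod_list (map gen (sorted_list_of_set A))"
proof -
  have "finite A"
    by simp
  then show ?thesis
  proof (induction A rule: finite_linorder_min_induct)
    case empty
    show ?case
      by (simp add: blade_empty)
  next
    case (insert b A)
    have "sorted_list_of_set (insert b A) = b # sorted_list_of_set A"
      using insert by (intro sorted_list_of_set_unique[THEN iffD1]) auto
    moreover have "gen b * blade A = blade (insert b A)"
    proof -
      have "blade_sign {b} A = 1"
        unfolding blade_sign_prod using insert by (auto intro!: prod.neutral)
      moreover have "sym_diff {b} A = insert b A"
        using insert by auto
      ultimately show ?thesis
        by (simp add: blade_times)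
    qed
    ultimately show ?case
      by (simp flip: insert.IH)
  qed
qed

lemma blade_expansion:
  fixes x :: "'n::finite clifford"
  shows "x = (\<Sum>A\<in>UNIV. f A *\<^sub>R blade A) \<longleftrightarrow> f = coeff x"
proof -
  have "coeff (\<Sum>A\<in>UNIV. f A *\<^sub>R blade A) B = f B" for B
    by (simp add: coeff_blade if_distrib cong: if_cong)
  then show ?thesis
    by (metis clifford_eqI ext)
qed


section \<open>Paravectors and the hypercomplex derivative\<close>

definition paravectors :: "'n::{finite,linorder} clifford set" where
  "paravectors = span (insert 1 (range gen))"

definition scalar_part :: "'n clifford \<Rightarrow> real" where
  "scalar_part x = coeff x {}"

definition vector_part :: "'n::finite clifford \<Rightarrow> 'n clifford" where
  "vector_part x = (\<Sum>k\<in>UNIV. coeff x {k} *\<^sub>R gen k)"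

lemma vector_part_one [simp]: "vector_part 1 = 0"
  by (simp add: vector_part_def coeff_one)

lemma vector_part_gen [simp]: "vector_part (gen i) = gen i"
proof -
  have "vector_part (gen i) = (\<Sum>k\<in>UNIV. if k = i then gen i else 0)"
    unfolding vector_part_def by (rule sum.cong) (auto simp: coeff_blade)
  then show ?thesis
    by simp
qed

lemma paravector_decomp:
  assumes "x \<in> paravectors"
  shows "x = of_real (scalar_part x) + vector_part x"
  using assms unfolding paravectors_def
proof (induction rule: span_induct_alt)
  case base
  show ?case
    by (simp add: scalar_part_def vector_part_def)
next
  case (step c y z)
  have "y = of_real (scalar_part y) + vector_part y"
    using step(1)
    by (auto simp: scalar_part_def coeff_one coeff_blade)
  moreover have "of_real (scalar_part (c *\<^sub>R y + z)) + vector_part (c *\<^sub>R y + z)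
    = c *\<^sub>R (of_real (scalar_part y) + vector_part y) + (of_real (scalar_part z) + vector_part z)"
    by (simp add: scalar_part_def vector_part_def of_real_def algebra_simps sum.distrib scaleR_sum_right)
  ultimately show ?case
    using step(2) by simp
qed

text \<open>
  The coordinate directions of $\mathbb{R}^{n+1}$ are $1$ (for $x_0$) and \<open>gen k\<close> (for $x_k$).
  Since they lie in \<open>paravectors\<close>, the derivatives at a point of \<open>paravectors\<close> only involve the
  values of the function there.
\<close>

definition partial_deriv ::
    "'n::finite clifford \<Rightarrow> ('n clifford \<Rightarrow> 'n clifford) \<Rightarrow> 'n clifford \<Rightarrow> 'n clifford" where
  "partial_deriv v f x = vector_derivative (\<lambda>t. f (x + t *\<^sub>R v)) (at 0)"

definition dirac ::
    "('n::{finite,linorder} clifford \<Rightarrow> 'n clifford) \<Rightarrow> 'n clifford \<Rightarrow> 'n clifford" where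
  "dirac f x = (\<Sum>k\<in>UNIV. gen k * partial_deriv (gen k) f x)"

definition hyper_deriv ::
    "('n::{finite,linorder} clifford \<Rightarrow> 'n clifford) \<Rightarrow> 'n clifford \<Rightarrow> 'n clifford" where
  "hyper_deriv f x = (1 / 2) *\<^sub>R (partial_deriv 1 f x - dirac f x)"

definition hyper_deriv_vec ::
    "('n::{finite,linorder} clifford \<Rightarrow> 'n clifford Matrix.vec) \<Rightarrow> 'n clifford \<Rightarrow> 'n clifford Matrix.vec" where
  "hyper_deriv_vec F x = Matrix.vec (dim_vec (F x)) (\<lambda>i. hyper_deriv (\<lambda>y. vec_index (F y) i) x)"


section \<open>The matrix exponential and the polynomial vector\<close>

text \<open>The exponential series is taken entrywise.\<close>

definition mat_exp :: "real mat \<Rightarrow> real mat" where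
  "mat_exp A = Matrix.mat (dim_row A) (dim_row A)
     (\<lambda>(i, j). \<Sum>k. (A ^\<^sub>m k) $$ (i, j) / fact k)"

definition mat_H :: "nat \<Rightarrow> real mat" where
  "mat_H m = Matrix.mat (m + 1) (m + 1) (\<lambda>(i, j). if i = j + 1 then real i else 0)"

text \<open>Real matrices act on Clifford-valued vectors via the embedding of the scalars.\<close>

definition mat_act :: "real mat \<Rightarrow> 'n::{finite,linorder} clifford Matrix.vec \<Rightarrow> 'n clifford Matrix.vec" where
  "mat_act A v = map_mat of_real A *\<^sub>v v"

definition xi :: "nat \<Rightarrow> 'n::{finite,linorder} clifford \<Rightarrow> 'n clifford Matrix.vec" where
  "xi m v = Matrix.vec (m + 1) (\<lambda>j. v ^ j)"

definition phi :: "nat \<Rightarrow> (nat \<Rightarrow> real) \<Rightarrow> 'n::{finite,linorder} clifford \<Rightarrow> 'n clifford Matrix.vec" where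
  "phi m c x = mat_act (mat_exp (scalar_part x \<cdot>\<^sub>m mat_H m) * mat_diag (m + 1) c)
     (xi m (vector_part x))"

lemma dim_phi [simp]: "dim_vec (phi m c x) = m + 1"
  by (simp add: phi_def mat_act_def mat_exp_def mat_H_def)

lemma mat_H_power:
  assumes "i \<le> m" "j \<le> m"
  shows "((r \<cdot>\<^sub>m mat_H m) ^\<^sub>m k) $$ (i, j) = (if i = j + k then r ^ k * fact i / fact j else 0)"
  using assms
proof (induction k arbitrary: i j)
  case 0
  then show ?case
    by (auto simp: mat_H_def)
next
  case (Suc k)
  let ?A = "r \<cdot>\<^sub>m mat_H m"
  have A: "?A \<in> carrier_mat (m + 1) (m + 1)"
    by (simp add: mat_H_def)
  have Ak: "?A ^\<^sub>m k \<in> carrier_mat (m + 1) (m + 1)"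
    using A by (rule pow_carrier_mat)
  have "(?A ^\<^sub>m Suc k) $$ (i, j) = (\<Sum>l = 0..<m + 1. (?A ^\<^sub>m k) $$ (i, l) * ?A $$ (l, j))"
    using Suc.prems carrier_matD[OF A] carrier_matD[OF Ak]
    by (simp add: scalar_prod_def del: sum.op_ivl_Suc)
  also have "\<dots> = (\<Sum>l = 0..<m + 1. if l = j + 1 then
      (if i = j + Suc k then r ^ Suc k * fact i / fact j else 0) else 0)"
    using Suc by (intro sum.cong) (auto simp: mat_H_def)
  also have "\<dots> = (if i = j + Suc k then r ^ Suc k * fact i / fact j else 0)"
    using Suc.prems by auto
  finally show ?case .
qed

lemma mat_exp_H:
  assumes "i \<le> m" "j \<le> m"
  shows "mat_exp (r \<cdot>\<^sub>m mat_H m) $$ (i, j) = (if j \<le> i then real (i choose j) * r ^ (i - j) else 0)"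
proof -
  have "mat_exp (r \<cdot>\<^sub>m mat_H m) $$ (i, j)
      = (\<Sum>k. ((r \<cdot>\<^sub>m mat_H m) ^\<^sub>m k) $$ (i, j) / fact k)"
    using assms by (simp add: mat_exp_def mat_H_def)
  also have "\<dots> = (\<Sum>k. if i = j + k then r ^ k * fact i / fact j / fact k else 0)"
    using assms by (auto simp: mat_H_power intro!: suminf_cong)
  also have "\<dots> = (\<Sum>k\<in>{i - j}. if i = j + k then r ^ k * fact i / fact j / fact k else 0)"
    by (rule suminf_finite) auto
  also have "\<dots> = (if j \<le> i then real (i choose j) * r ^ (i - j) else 0)"
    by (auto simp: binomial_fact)
  finally show ?thesis .
qed

lemma phi_index:
  assumes "k \<le> m"
  shows "vec_index (phi m c x) k =
    (\<Sum>j\<le>k. (real (k choose j) * c j * scalar_part x ^ (k - j)) *\<^sub>R vector_part x ^ j)"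
proof -
  let ?E = "mat_exp (scalar_part x \<cdot>\<^sub>m mat_H m)"
  have E: "?E \<in> carrier_mat (Suc m) (Suc m)"
    by (simp add: mat_exp_def mat_H_def)
  have "vec_index (phi m c x) k
      = (\<Sum>j = 0..<m + 1. of_real (?E $$ (k, j) * c j) * vector_part x ^ j)"
    using assms carrier_matD[OF E]
    by (auto simp: phi_def mat_act_def xi_def mat_diag_mult_right[OF E] scalar_prod_def
        simp del: sum.op_ivl_Suc intro!: sum.cong)
  also have "\<dots> = (\<Sum>j\<in>{..m}. if j \<le> k then
      (real (k choose j) * c j * scalar_part x ^ (k - j)) *\<^sub>R vector_part x ^ j else 0)"
    using assms by (intro sum.cong) (auto simp: mat_exp_H of_real_def mult_ac)
  also have "\<dots> = (\<Sum>j\<in>{j\<in>{..m}. j \<le> k}.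
      (real (k choose j) * c j * scalar_part x ^ (k - j)) *\<^sub>R vector_part x ^ j)"
    by (rule sum.inter_filter[symmetric]) simp
  also have "{j\<in>{..m}. j \<le> k} = {..k}"
    using assms by auto
  finally show ?thesis .
qed

fun double_fact :: "nat \<Rightarrow> nat" where
  "double_fact 0 = 1"
| "double_fact (Suc 0) = 1"
| "double_fact (Suc (Suc N)) = Suc (Suc N) * double_fact N"

end

theory Submission
  imports Defs
begin

text \<open>
  Write $s$ and $v$ for the scalar and the vector part of $x$. Componentwise,
  $\phi_k = \sum_j \binom{k}{j} c_j s^{k-j} v^j$, and both halves of
  $\partial = \frac12(\partial_0 - \partial_{\underline{x}})$ turn out to produce the same
  function $k\,\phi_{k-1}$, so that their mean is again $k\,\phi_{k-1}$.

  For $\partial_0$ this is the Appell property of binomial sums, valid for every choice of the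
  $c_j$. For the Dirac operator the non-commutative product rule gives
  $\sum_k e_k (\sum_{i<j} v^i e_k v^{j-1-i})$, so one has to know the sandwich
  $\sum_k e_k v^i e_k$. Since $v^2$ is a real scalar, only $i = 0$ and $i = 1$ matter, and there
  the sandwich multiplies by $-n$ and by $n - 2$ (\<open>gen_sandwich_power\<close>). Summing these
  alternating factors yields $-\partial_{\underline{x}} v^j = \gamma_j v^{j-1}$ with
  $\gamma_j = j$ for even $j$ and $\gamma_j = j + n - 1$ for odd $j$ (\<open>dirac_power\<close>).
  Comparing coefficients with $k\,\phi_{k-1}$, what is left is the recurrence
  $\gamma_{j+1} c_{j+1} = (j+1) c_j$ (\<open>double_fact_recurrence\<close>): it says $c_{2l} = c_{2l-1}$
  and $(n+2l)\,c_{2l+1} = (2l+1)\,c_{2l}$, which is what the double factorials are made for.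
\<close>

section \<open>Differentiating Clifford products\<close>

text \<open>
  The norm is Euclidean on the coordinates, so it is not submultiplicative in general; the crude
  bound $\|xy\| \le 4^n \|x\| \|y\|$ is enough for the product rule for bounded bilinear maps.
\<close>

lemma bounded_bilinear_clifford_times:
  "bounded_bilinear ((*) :: 'n::{finite,linorder} clifford \<Rightarrow> 'n clifford \<Rightarrow> 'n clifford)"
proof (rule bounded_bilinear.intro)
  let ?N = "real (CARD('n set))"
  have coeff_le: "\<bar>coeff x A\<bar> \<le> norm x" for x :: "'n clifford" and A
    using member_le_L2_set[of UNIV A "\<lambda>B. \<bar>coeff x B\<bar>"]
    by (simp add: norm_clifford_def L2_set_def)
  have sign: "\<bar>blade_sign A B\<bar> = 1" for A B :: "'n set"
    by (simp add: blade_sign_def power_abs)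
  have "norm (x * y) \<le> norm x * norm y * (?N * ?N)" for x y :: "'n clifford"
  proof -
    have "\<bar>coeff (x * y) C\<bar> \<le> ?N * (norm x * norm y)" for C
    proof -
      have "\<bar>coeff (x * y) C\<bar> \<le>
          (\<Sum>A\<in>UNIV. \<bar>blade_sign A (sym_diff A C) * coeff x A * coeff y (sym_diff A C)\<bar>)"
        unfolding coeff_times by (rule sum_abs)
      also have "\<dots> \<le> (\<Sum>A\<in>(UNIV :: 'n set set). norm x * norm y)"
        by (intro sum_mono) (auto simp: abs_mult sign intro!: mult_mono coeff_le)
      finally show ?thesis by simp
    qed
    then have "(\<Sum>C\<in>UNIV. \<bar>coeff (x * y) C\<bar>) \<le> (\<Sum>C\<in>(UNIV :: 'n set set). ?N * (norm x * norm y))"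
      by (intro sum_mono)
    then have "(\<Sum>C\<in>UNIV. \<bar>coeff (x * y) C\<bar>) \<le> norm x * norm y * (?N * ?N)"
      by (simp add: mult_ac)
    moreover have "norm (x * y) \<le> (\<Sum>C\<in>UNIV. \<bar>coeff (x * y) C\<bar>)"
      unfolding norm_clifford_def by (rule L2_set_le_sum_abs)
    ultimately show ?thesis by linarith
  qed
  then show "\<exists>K. \<forall>x y :: 'n clifford. norm (x * y) \<le> norm x * norm y * K"
    by blast
qed (auto simp: algebra_simps)

lemma has_vector_derivative_clifford_power:
  fixes v e :: "'n::{finite,linorder} clifford"
  shows "((\<lambda>t. (v + t *\<^sub>R e) ^ j) has_vector_derivative
    (\<Sum>i<j. v ^ i * e * v ^ (j - Suc i))) (at 0)"
proof (induction j)
  case 0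
  show ?case by simp
next
  case (Suc j)
  have lin: "((\<lambda>t. v + t *\<^sub>R e) has_vector_derivative e) (at 0)"
    by (auto intro!: derivative_eq_intros)
  have shift: "(\<Sum>i<j. v ^ i * e * v ^ (j - Suc i)) * v = (\<Sum>i<j. v ^ i * e * v ^ (j - i))"
    unfolding sum_distrib_right
    by (intro sum.cong) (auto simp: mult.assoc power_Suc2[symmetric] Suc_diff_Suc simp del: power_Suc)
  show ?case
    using bounded_bilinear.has_vector_derivative[OF bounded_bilinear_clifford_times Suc.IH lin]
    by (simp add: shift power_Suc2 add.commute del: power_Suc)
qed


section \<open>Powers of a vector under the Dirac operator\<close>

lemma scalar_part_add_scaleR [simp]:
  "scalar_part (x + t *\<^sub>R y) = scalar_part x + t * scalar_part y"
  by (simp add: scalar_part_def)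

lemma vector_part_add_scaleR [simp]:
  "vector_part (x + t *\<^sub>R y) = vector_part x + t *\<^sub>R vector_part y"
  by (simp add: vector_part_def algebra_simps sum.distrib scaleR_sum_right)

lemma gen_times_vector_part:
  fixes x :: "'n::{finite,linorder} clifford"
  shows "gen k * vector_part x = - (vector_part x * gen k) - (2 * coeff x {k}) *\<^sub>R 1"
proof -
  have "(2 :: 'n clifford) = 1 + 1"
    by simp
  then have minus_two: "r *\<^sub>R (- 2 :: 'n clifford) = - ((2 * r) *\<^sub>R 1)" for r
    by (simp only: scaleR_minus_right scaleR_add_right scaleR_add_left mult_2)
  have "gen k * vector_part x + vector_part x * gen k
      = (\<Sum>i\<in>UNIV. coeff x {i} *\<^sub>R (gen k * gen i + gen i * gen k))"
    by (simp add: vector_part_def sum_distrib_left sum_distrib_right sum.distrib scaleR_add_right)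
  also have "\<dots> = (\<Sum>i\<in>UNIV. if i = k then - ((2 * coeff x {k}) *\<^sub>R 1) else 0)"
    by (intro sum.cong) (auto simp only: gen_anticommute minus_two scaleR_zero_right split: if_splits)
  finally show ?thesis
    by (simp add: algebra_simps eq_neg_iff_add_eq_0)
qed

lemma gen_square: "gen k * gen k = (- 1 :: 'n::{finite,linorder} clifford)"
  by (simp add: blade_times blade_sign_prod blade_empty)

text \<open>
  Expanding only the left factor and moving each \<open>gen k\<close> past $v$ gives
  $v^2 = -v^2 - 2 \sum_k v_k^2$, so no double sum over generators is needed.
\<close>

lemma vector_part_square:
  fixes x :: "'n::{finite,linorder} clifford"
  obtains r where "vector_part x * vector_part x = of_real r"
proof
  let ?v = "vector_part x" and ?q = "\<Sum>k\<in>UNIV. coeff x {k} ^ 2"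
  have "?v * ?v = (\<Sum>k\<in>UNIV. coeff x {k} *\<^sub>R (gen k * ?v))"
    by (subst (1) vector_part_def) (simp add: sum_distrib_right)
  also have "\<dots> = - (\<Sum>k\<in>UNIV. ?v * (coeff x {k} *\<^sub>R gen k))
      - (\<Sum>k\<in>UNIV. (2 * coeff x {k} ^ 2) *\<^sub>R 1)"
    by (simp add: gen_times_vector_part scaleR_diff_right sum_subtractf sum_negf
        power2_eq_square mult_ac)
  also have "(\<Sum>k\<in>UNIV. ?v * (coeff x {k} *\<^sub>R gen k)) = ?v * ?v"
    by (simp only: sum_distrib_left[symmetric] vector_part_def[of x, symmetric])
  also have "(\<Sum>k\<in>UNIV. (2 * coeff x {k} ^ 2) *\<^sub>R 1) = 2 *\<^sub>R of_real ?q"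
    by (simp add: of_real_def scaleR_sum_left scaleR_sum_right)
  finally have "?v * ?v + ?v * ?v = ?v * ?v + (- (?v * ?v) - 2 *\<^sub>R of_real ?q)"
    by (rule arg_cong)
  then have "2 *\<^sub>R (?v * ?v) = 2 *\<^sub>R (- of_real ?q)"
    by (simp only: scaleR_2) simp
  then have "?v * ?v = - of_real ?q"
    by (rule scaleR_left_imp_eq[rotated]) simp
  then show "?v * ?v = of_real (- ?q)"
    by (simp only: of_real_minus)
qed

text \<open>
  Anticommuting \<open>gen k\<close> past $v$ gives $e_k v e_k = v - 2 v_k e_k$, whose sum over $k$ is
  $(n - 2) v$. An even power is a real scalar and commutes with everything, so the parity of
  the exponent alone decides the factor.
\<close>

lemma gen_sandwich_power:
  fixes x :: "'n::{finite,linorder} clifford"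
  shows "(\<Sum>k\<in>UNIV. gen k * vector_part x ^ i * gen k) =
    (if even i then - real (CARD('n)) else real (CARD('n)) - 2) *\<^sub>R vector_part x ^ i"
proof -
  let ?v = "vector_part x" and ?n = "real (CARD('n))"
  obtain r where r: "?v * ?v = of_real r"
    by (rule vector_part_square)
  have even_power: "?v ^ (2 * l) = r ^ l *\<^sub>R 1" for l
    by (simp add: power_mult power2_eq_square r flip: of_real_power) (simp add: of_real_def)
  have "gen k * ?v * gen k = ?v - 2 *\<^sub>R (coeff x {k} *\<^sub>R gen k)" for k
    by (simp add: gen_times_vector_part left_diff_distrib mult.assoc gen_square)
  then have "(\<Sum>k\<in>UNIV. gen k * ?v * gen k)
      = ?n *\<^sub>R ?v - 2 *\<^sub>R (\<Sum>k\<in>UNIV. coeff x {k} *\<^sub>R gen k)"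
    by (simp only: sum_subtractf scaleR_sum_right sum_constant_scaleR)
  then have vector: "(\<Sum>k\<in>UNIV. gen k * ?v * gen k) = (?n - 2) *\<^sub>R ?v"
    by (simp only: vector_part_def[of x, symmetric] scaleR_left_diff_distrib)
  show ?thesis
  proof (cases "even i")
    case True
    then obtain l where "i = 2 * l" by blast
    then show ?thesis
      by (simp add: even_power gen_square sum_constant_scaleR del: sum_constant)
  next
    case False
    then obtain l where i: "i = 2 * l + 1" by (rule oddE)
    have "?v ^ i = r ^ l *\<^sub>R ?v"
      by (simp only: i power_add even_power power_one_right mult_scaleR_left mult_1_left)
    then show ?thesis
      using False vector by (simp flip: scaleR_sum_right)
  qed
qed

text \<open>
  Minus the partial sums of the alternating factors $-n, n - 2, -n, \dots$ of
  \<open>gen_sandwich_power\<close>: each consecutive pair of them adds up to $-2$.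
\<close>

definition dirac_factor :: "nat \<Rightarrow> nat \<Rightarrow> real" where
  "dirac_factor n j = (if even j then real j else real j + real n - 1)"

lemma dirac_power:
  fixes x :: "'n::{finite,linorder} clifford"
  shows "(\<Sum>k\<in>UNIV. gen k * (\<Sum>i<j. vector_part x ^ i * gen k * vector_part x ^ (j - Suc i))) =
    - dirac_factor (CARD('n)) j *\<^sub>R vector_part x ^ (j - 1)"
proof -
  let ?v = "vector_part x" and ?n = "real (CARD('n))"
  let ?d = "\<lambda>i::nat. if even i then - ?n else ?n - 2"
  have "(\<Sum>k\<in>UNIV. gen k * (\<Sum>i<j. ?v ^ i * gen k * ?v ^ (j - Suc i)))
      = (\<Sum>i<j. (\<Sum>k\<in>UNIV. gen k * ?v ^ i * gen k) * ?v ^ (j - Suc i))"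
    unfolding sum_distrib_left sum_distrib_right
    by (subst sum.swap) (simp add: mult.assoc)
  also have "\<dots> = (\<Sum>i<j. ?d i *\<^sub>R ?v ^ (j - 1))"
    by (intro sum.cong) (auto simp: gen_sandwich_power simp flip: power_add)
  also have "\<dots> = (\<Sum>i<j. ?d i) *\<^sub>R ?v ^ (j - 1)"
    by (rule scaleR_sum_left[symmetric])
  also have "(\<Sum>i<j. ?d i) = - dirac_factor (CARD('n)) j"
    by (induction j) (auto simp: dirac_factor_def)
  finally show ?thesis .
qed


section \<open>The coefficients\<close>

lemma double_fact_pos: "double_fact N > 0"
  by (induction N rule: double_fact.induct) auto

lemma double_fact_recurrence:
  fixes c :: "nat \<Rightarrow> real"
  assumes "n > 1"
    and even: "\<And>k. 1 \<le> k \<Longrightarrow> 2 * k \<le> m \<Longrightarrow>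
      c (2 * k) = real (double_fact (2 * k - 1)) * real (double_fact (n - 2))
        / real (double_fact (n + 2 * k - 2)) * c 0"
    and odd: "\<And>k. 1 \<le> k \<Longrightarrow> 2 * k - 1 \<le> m \<Longrightarrow>
      c (2 * k - 1) = real (double_fact (2 * k - 1)) * real (double_fact (n - 2))
        / real (double_fact (n + 2 * k - 2)) * c 0"
    and "j < m"
  shows "dirac_factor n (Suc j) * c (Suc j) = real (Suc j) * c j"
proof (cases "even j")
  case False
  then obtain l where j: "j = 2 * l + 1" by (rule oddE)
  have "c (Suc j) = c j"
    using even[of "Suc l"] odd[of "Suc l"] \<open>j < m\<close> j by simp
  then show ?thesis
    using False by (simp add: dirac_factor_def)
next
  case True
  then obtain l where j: "j = 2 * l" by blast
  define p where "p = n - 2"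
  have n: "n = Suc (Suc p)"
    using \<open>n > 1\<close> by (simp add: p_def)
  define F where "F = (\<lambda>N. real (double_fact N))"
  have F: "F N > 0" "F (Suc (Suc N)) = (real N + 2) * F N" for N
    by (simp_all add: F_def double_fact_pos algebra_simps)
  \<comment> \<open>Truncated subtraction gives \<open>0 - 1 = 0\<close>, hence \<open>(-1)!! = 1\<close>, and \<open>l = 0\<close> fits the pattern.\<close>
  have cj: "c j = F (2 * l - 1) * F p / F (p + 2 * l) * c 0"
    using even[of l] \<open>j < m\<close> F(1)[of p] by (cases "l = 0") (auto simp: j n F_def)
  have cSj: "c (Suc j) = F (2 * l + 1) * F p / F (Suc (Suc (p + 2 * l))) * c 0"
    using odd[of "Suc l"] \<open>j < m\<close> by (simp add: j n F_def)
  have "F (2 * l + 1) = (2 * real l + 1) * F (2 * l - 1)"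
  proof (cases l)
    case (Suc l')
    then show ?thesis using F(2)[of "2 * l' + 1"] by simp
  qed (simp add: F_def)
  moreover have "dirac_factor n (Suc j) = real (p + 2 * l) + 2"
    using True by (simp add: dirac_factor_def j n)
  moreover have "real (p + 2 * l) + 2 \<noteq> 0"
    by linarith
  ultimately show ?thesis
    using F(1)[of "p + 2 * l"] unfolding cj cSj F(2) by (simp add: j)
qed


section \<open>The hypercomplex derivative of the polynomials\<close>

definition appell_sum :: "(nat \<Rightarrow> real) \<Rightarrow> nat \<Rightarrow> 'n::{finite,linorder} clifford \<Rightarrow> 'n clifford" where
  "appell_sum c k x =
    (\<Sum>j\<le>k. (real (k choose j) * c j * scalar_part x ^ (k - j)) *\<^sub>R vector_part x ^ j)"

text \<open>
  Moving in direction \<open>1\<close> changes only the scalar part, and $(k - j) \binom{k}{j} = k \binom{k-1}{j}$.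
\<close>

lemma partial_deriv_one_appell_sum:
  fixes x :: "'n::{finite,linorder} clifford"
  shows "partial_deriv 1 (appell_sum c k) x = real k *\<^sub>R appell_sum c (k - 1) x"
proof -
  let ?s = "scalar_part x" and ?v = "vector_part x"
  have one: "scalar_part (1 :: 'n clifford) = 1"
    by (simp add: scalar_part_def coeff_one)
  have power_deriv: "((\<lambda>t. (?s + t) ^ i) has_real_derivative real i * ?s ^ (i - 1)) (at 0)" for i
    by (auto intro!: derivative_eq_intros)
  have "((\<lambda>t. appell_sum c k (x + t *\<^sub>R 1)) has_vector_derivative
      (\<Sum>j\<le>k. (real (k choose j) * c j * (real (k - j) * ?s ^ (k - j - 1))) *\<^sub>R ?v ^ j)) (at 0)"
    unfolding appell_sum_def
    by (intro has_vector_derivative_sum)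
      (auto simp: one intro!: derivative_eq_intros power_deriv[THEN DERIV_cmult])
  also have "(\<Sum>j\<le>k. (real (k choose j) * c j * (real (k - j) * ?s ^ (k - j - 1))) *\<^sub>R ?v ^ j)
      = real k *\<^sub>R appell_sum c (k - 1) x"
  proof (cases k)
    case (Suc k')
    have "real (Suc k' - j) * real (Suc k' choose j) = real (Suc k') * real (k' choose j)"
      if "j \<le> k'" for j
      using binomial_absorb_comp[of "Suc k'" j] by (metis diff_Suc_1 of_nat_mult)
    then show ?thesis
      unfolding Suc appell_sum_def
      by (auto simp: scaleR_sum_right mult_ac intro!: sum.cong simp del: of_nat_Suc)
  qed (simp add: appell_sum_def)
  finally show ?thesis
    unfolding partial_deriv_def by (rule vector_derivative_at)
qed

text \<open>
  The Dirac operator lowers the power of the vector part instead; the recurrence turns the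
  coefficient of $v^j$ into $(j + 1) \binom{k}{j+1} c_j = k \binom{k-1}{j} c_j$, the one that
  differentiating in the scalar direction produces.
\<close>

lemma dirac_appell_sum:
  fixes x :: "'n::{finite,linorder} clifford"
  assumes rec: "\<And>j. j < k \<Longrightarrow> dirac_factor (CARD('n)) (Suc j) * c (Suc j) = real (Suc j) * c j"
  shows "dirac (appell_sum c k) x = - (real k *\<^sub>R appell_sum c (k - 1) x)"
proof -
  let ?s = "scalar_part x" and ?v = "vector_part x"
  let ?a = "\<lambda>j. real (k choose j) * c j * ?s ^ (k - j)"
  let ?D = "\<lambda>e j. \<Sum>i<j. ?v ^ i * e * ?v ^ (j - Suc i)"
  have "scalar_part (gen l) = 0" for l :: 'n
    by (simp add: scalar_part_def coeff_blade)
  then have "((\<lambda>t. appell_sum c k (x + t *\<^sub>R gen l)) has_vector_derivative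
      (\<Sum>j\<le>k. ?a j *\<^sub>R ?D (gen l) j)) (at 0)" for l
    unfolding appell_sum_def
    by (auto intro!: has_vector_derivative_sum has_vector_derivative_clifford_power
        bounded_linear.has_vector_derivative[OF bounded_linear_scaleR_right])
  then have "partial_deriv (gen l) (appell_sum c k) x = (\<Sum>j\<le>k. ?a j *\<^sub>R ?D (gen l) j)" for l
    unfolding partial_deriv_def by (rule vector_derivative_at)
  then have "dirac (appell_sum c k) x = (\<Sum>j\<le>k. ?a j *\<^sub>R (\<Sum>l\<in>UNIV. gen l * ?D (gen l) j))"
    unfolding dirac_def
    by (simp add: sum_distrib_left[of _ _ "{..k}"] scaleR_sum_right[of _ _ UNIV])
      (rule sum.swap)
  also have "\<dots> = - (\<Sum>j\<le>k. (?a j * dirac_factor (CARD('n)) j) *\<^sub>R ?v ^ (j - 1))"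
    by (simp add: dirac_power sum_negf)
  also have "(\<Sum>j\<le>k. (?a j * dirac_factor (CARD('n)) j) *\<^sub>R ?v ^ (j - 1))
      = real k *\<^sub>R appell_sum c (k - 1) x"
  proof (cases k)
    case (Suc k')
    have "?a (Suc j) * dirac_factor (CARD('n)) (Suc j)
        = real (Suc k') * (real (k' choose j) * c j * ?s ^ (k' - j))" if "j \<le> k'" for j
    proof -
      have "?a (Suc j) * dirac_factor (CARD('n)) (Suc j)
          = real (Suc k' choose Suc j) * (dirac_factor (CARD('n)) (Suc j) * c (Suc j)) * ?s ^ (k' - j)"
        by (simp add: Suc)
      also have "\<dots> = (real (Suc j) * real (Suc k' choose Suc j)) * c j * ?s ^ (k' - j)"
        using rec[of j] that Suc by (simp del: of_nat_Suc binomial_Suc_Suc)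
      also have "real (Suc j) * real (Suc k' choose Suc j) = real (Suc k') * real (k' choose j)"
        using Suc_times_binomial[of j k'] by (metis of_nat_mult)
      finally show ?thesis
        by (simp add: mult_ac)
    qed
    moreover have "dirac_factor (CARD('n)) 0 = 0"
      by (simp add: dirac_factor_def)
    ultimately show ?thesis
      unfolding Suc appell_sum_def
      by (subst sum.atMost_Suc_shift)
        (auto simp: Suc scaleR_sum_right intro!: sum.cong simp del: of_nat_Suc binomial_Suc_Suc)
  qed (simp add: appell_sum_def dirac_factor_def)
  finally show ?thesis .
qed

lemma hyper_deriv_appell_sum:
  fixes x :: "'n::{finite,linorder} clifford"
  assumes "\<And>j. j < k \<Longrightarrow> dirac_factor (CARD('n)) (Suc j) * c (Suc j) = real (Suc j) * c j"
  shows "hyper_deriv (appell_sum c k) x = of_nat k * appell_sum c (k - 1) x"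
proof -
  have dirac: "dirac (appell_sum c k) x = - (real k *\<^sub>R appell_sum c (k - 1) x)"
    using assms by (rule dirac_appell_sum)
  have double: "y - - y = 2 *\<^sub>R y" for y :: "'n clifford"
    by (simp add: scaleR_2)
  have "hyper_deriv (appell_sum c k) x = real k *\<^sub>R appell_sum c (k - 1) x"
    unfolding hyper_deriv_def partial_deriv_one_appell_sum dirac double
    by simp
  then show ?thesis
    by (simp add: scaleR_conv_of_real)
qed

lemma mat_act_H_index:
  assumes "dim_vec w = m + 1" "i \<le> m"
  shows "vec_index (mat_act (mat_H m) w) i = of_nat i * vec_index w (i - 1)"
proof -
  have "vec_index (mat_act (mat_H m) w) i
      = (\<Sum>j = 0..<m + 1. of_real (if i = j + 1 then real i else 0) * vec_index w j)"
    using assms by (simp add: mat_act_def mat_H_def scalar_prod_def del: sum.op_ivl_Suc)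
  also have "\<dots> = (\<Sum>j = 0..<m + 1. if j = i - 1 then of_nat i * vec_index w j else 0)"
    by (intro sum.cong refl) (cases i; auto)
  finally show ?thesis
    using assms by (auto simp del: sum.op_ivl_Suc)
qed

theorem mainTheorem2:
  fixes m :: nat and c :: "nat \<Rightarrow> real"
  assumes "CARD('n::{finite,linorder}) > 1"
    and "c 0 \<noteq> 0"
    and "\<And>k. 1 \<le> k \<Longrightarrow> 2 * k \<le> m \<Longrightarrow>
      c (2 * k) = real (double_fact (2 * k - 1)) * real (double_fact (CARD('n) - 2))
        / real (double_fact (CARD('n) + 2 * k - 2)) * c 0"
    and "\<And>k. 1 \<le> k \<Longrightarrow> 2 * k - 1 \<le> m \<Longrightarrow>
      c (2 * k - 1) = real (double_fact (2 * k - 1)) * real (double_fact (CARD('n) - 2))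
        / real (double_fact (CARD('n) + 2 * k - 2)) * c 0"
  shows "\<forall>x \<in> (paravectors :: 'n clifford set).
      hyper_deriv_vec (phi m c) x = mat_act (mat_H m) (phi m c x) \<and>
      hyper_deriv (\<lambda>y. vec_index (phi m c y) 0) x = 0 \<and>
      (\<forall>k \<in> {1..m}. hyper_deriv (\<lambda>y. vec_index (phi m c y) k) x
                       = of_nat k * vec_index (phi m c x) (k - 1))"
proof
  fix x :: "'n clifford"
  assume "x \<in> paravectors"
  have rec: "dirac_factor (CARD('n)) (Suc j) * c (Suc j) = real (Suc j) * c j" if "j < m" for j
    using double_fact_recurrence[OF assms(1,3,4) that] by simp
  have phi: "(\<lambda>y :: 'n clifford. vec_index (phi m c y) k) = appell_sum c k" if "k \<le> m" for k
    using that by (auto simp: phi_index appell_sum_def)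
  have deriv: "hyper_deriv (\<lambda>y. vec_index (phi m c y) k) x
      = of_nat k * vec_index (phi m c x) (k - 1)" if "k \<le> m" for k
  proof -
    have "vec_index (phi m c x) (k - 1) = appell_sum c (k - 1) x"
      using that phi[of "k - 1"] by (metis diff_le_self order_trans)
    then show ?thesis
      using that rec by (simp add: phi hyper_deriv_appell_sum)
  qed
  have "hyper_deriv_vec (phi m c) x = mat_act (mat_H m) (phi m c x)"
  proof (rule eq_vecI)
    show "dim_vec (hyper_deriv_vec (phi m c) x) = dim_vec (mat_act (mat_H m) (phi m c x))"
      by (simp add: hyper_deriv_vec_def mat_act_def mat_H_def)
  next
    fix i
    assume "i < dim_vec (mat_act (mat_H m) (phi m c x))"
    then have "i \<le> m"
      by (simp add: mat_act_def mat_H_def)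
    then show "vec_index (hyper_deriv_vec (phi m c) x) i = vec_index (mat_act (mat_H m) (phi m c x)) i"
      by (simp add: hyper_deriv_vec_def deriv mat_act_H_index)
  qed
  then show "hyper_deriv_vec (phi m c) x = mat_act (mat_H m) (phi m c x) \<and>
      hyper_deriv (\<lambda>y. vec_index (phi m c y) 0) x = 0 \<and>
      (\<forall>k \<in> {1..m}. hyper_deriv (\<lambda>y. vec_index (phi m c y) k) x
                       = of_nat k * vec_index (phi m c x) (k - 1))"
    using deriv by simp
qed

end
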